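(* Let $C\in\Bbbk$ and let $X$ be a submultiset of $R_{u+C}$. Then the $\mathcal{S}_u$-module $A_C(X)$ has length $$1+\sum_{\beta\in\underline{R_{u+C}}}\varphi_X(\beta).$$
   Context: $\Bbbk$ is an algebraically closed field of characteristic zero. Fix a nonzero polynomial $g(h)\in\Bbbk[h]$ and a polynomial $u(h)\in\Bbbk[h]$ with $g(h)=u(h-1)-u(h)$ (such $u$ exists, is unique up to its constant term, and $\deg u=\deg g+1\geq 1$). The Smith algebra $\mathcal{S}_u$ is the unital associative $\Bbbk$-algebra generated by $x,y,h$ with defining relations $[h,y]=y$, $[h,x]=-x$, $[y,x]=g(h)$. $R_f$ denotes the multiset of roots of a nonzero polynomial $f$ (with multiplicity), and $\underline{Z}$ the underlying set of a multiset $Z$. Differences of multisets are taken with multiplicity. For $C\in\Bbbk$ and a submultiset $X\subseteq R_{u+C}$, put $q(h)=\prod_{\alpha\in X}(h-\alpha)$ (with multiplicity; empty product $=1$) and $p(h)=\frac{u(h-1)+C}{q(h-1)}\in\Bbbk[h]$. The module $A_C(X)$ is $\Bbbk[h]$ with $h$ acting by multiplication and $x\cdot f(h)=f(h+1)q(h)$, $y\cdot f(h)=f(h-1)p(h)$ for all $f\in\Bbbk[h]$. Define a partial order on $\Bbbk$ by $\alpha\preccurlyeq\beta$ iff $\beta-\alpha=n1_\Bbbk$ for some integer $n\geq 0$, and write $\alpha\prec\beta$ if moreover $\alpha\neq\beta$. For a multiset $Z$, $Z_{\prec\beta}=\{\alpha\in Z\mid\alpha\prec\beta\}$ and $Z_{\succcurlyeq\beta}=\{\alpha\in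 Z\mid\beta\preccurlyeq\alpha\}$ (submultisets), and $|\cdot|$ is cardinality with multiplicity. For a submultiset $Z\subseteq R_{u+C}$ and $\beta\in\underline{R_{u+C}}$, $\varphi_Z(\beta)=\min\{|(R_{u+C}\setminus Z)_{\prec\beta}|,\ |Z_{\succcurlyeq\beta}|\}$. *)

theory Defs
  imports
    "HOL-Library.Poly_Mapping"
    "HOL-Library.Extended_Nat"
    "HOL-Computational_Algebra.Polynomial"
    "HOL-Algebra.QuotRing"
    "HOL-Algebra.Module"
begin

section \<open>Left modules over a ring and their length\<close>

text \<open>
  The library locale \<^locale>\<open>module\<close> requires a commutative ring of scalars; the following is the
  same axiom list over an arbitrary ring. The library locale \<^locale>\<open>submodule\<close> does not mention
  commutativity and is used as it is.
\<close>

locale left_module = R?: ring R + M?: abelian_group M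
  for R (structure) and M (structure) +
  assumes smult_closed:
      "\<lbrakk>a \<in> carrier R; x \<in> carrier M\<rbrakk> \<Longrightarrow> a \<odot>\<^bsub>M\<^esub> x \<in> carrier M"
    and smult_l_distr:
      "\<lbrakk>a \<in> carrier R; b \<in> carrier R; x \<in> carrier M\<rbrakk> \<Longrightarrow>
        (a \<oplus> b) \<odot>\<^bsub>M\<^esub> x = a \<odot>\<^bsub>M\<^esub> x \<oplus>\<^bsub>M\<^esub> b \<odot>\<^bsub>M\<^esub> x"
    and smult_r_distr:
      "\<lbrakk>a \<in> carrier R; x \<in> carrier M; y \<in> carrier M\<rbrakk> \<Longrightarrow>
        a \<odot>\<^bsub>M\<^esub> (x \<oplus>\<^bsub>M\<^esub> y) = a \<odot>\<^bsub>M\<^esub> x \<oplus>\<^bsub>M\<^esub> a \<odot>\<^bsub>M\<^esub> y"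
    and smult_assoc1:
      "\<lbrakk>a \<in> carrier R; b \<in> carrier R; x \<in> carrier M\<rbrakk> \<Longrightarrow>
        (a \<otimes> b) \<odot>\<^bsub>M\<^esub> x = a \<odot>\<^bsub>M\<^esub> (b \<odot>\<^bsub>M\<^esub> x)"
    and smult_one: "x \<in> carrier M \<Longrightarrow> \<one> \<odot>\<^bsub>M\<^esub> x = x"

definition submodule_chain ::
  "('r, 's) ring_scheme \<Rightarrow> ('r, 'm, 't) module_scheme \<Rightarrow> nat \<Rightarrow> (nat \<Rightarrow> 'm set) \<Rightarrow> bool"
  where "submodule_chain R M n N \<longleftrightarrow>
    (\<forall>i\<le>n. submodule (N i) R M) \<and> (\<forall>i<n. N i \<subset> N (Suc i))"

text \<open>
  The length is the supremum of the lengths \<open>n\<close> of strict chains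
  \<open>N 0 \<subset> N 1 \<subset> \<dots> \<subset> N n\<close> of submodules, with value \<open>\<infinity>\<close> if these are unbounded.
\<close>

definition module_length :: "('r, 's) ring_scheme \<Rightarrow> ('r, 'm, 't) module_scheme \<Rightarrow> enat"
  where "module_length R M = Sup {enat n | n. \<exists>N. submodule_chain R M n N}"


section \<open>The free associative algebra\<close>

text \<open>
  The free associative \<open>\<bbbk>\<close>-algebra is the monoid algebra of the free monoid of words: the product
  of \<^typ>\<open>'w \<Rightarrow>\<^sub>0 'a\<close> is the convolution along the (here non-commutative) addition of \<open>'w\<close>,
  which for words is concatenation.
\<close>

datatype 'g word = Word (letters: "'g list")

instantiation word :: (type) monoid_add
begin

definition "0 = Word []"
definition "v + w = Word (letters v @ letters w)"

instance
  by standard (simp_all add: zero_word_def plus_word_def)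

end

definition free_gen :: "'g \<Rightarrow> 'g word \<Rightarrow>\<^sub>0 'a::comm_ring_1"
  where "free_gen c = Poly_Mapping.single (Word [c]) 1"

definition free_scalar :: "'a \<Rightarrow> 'g word \<Rightarrow>\<^sub>0 'a::comm_ring_1"
  where "free_scalar c = Poly_Mapping.single 0 c"

text \<open>\<^const>\<open>poly\<close> only evaluates in commutative rings.\<close>

definition free_eval :: "'a poly \<Rightarrow> ('g word \<Rightarrow>\<^sub>0 'a) \<Rightarrow> 'g word \<Rightarrow>\<^sub>0 'a::comm_ring_1"
  where "free_eval f a = (\<Sum>i\<le>Polynomial.degree f. free_scalar (Polynomial.coeff f i) * a ^ i)"

definition free_algebra :: "('g word \<Rightarrow>\<^sub>0 'a::comm_ring_1) ring"
  where "free_algebra = \<lparr>carrier = UNIV, mult = (*), one = 1, zero = 0, add = (+)\<rparr>"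


section \<open>The Smith algebra\<close>

datatype smith_gen = GX | GY | GH

definition smith_relations :: "'a poly \<Rightarrow> (smith_gen word \<Rightarrow>\<^sub>0 'a::comm_ring_1) set"
  where "smith_relations g =
    (let x = free_gen GX; y = free_gen GY; h = free_gen GH in
      {(h * y - y * h) - y,
       (h * x - x * h) - (- x),
       (y * x - x * y) - free_eval g h})"

definition smith_ideal :: "'a poly \<Rightarrow> (smith_gen word \<Rightarrow>\<^sub>0 'a::comm_ring_1) set"
  where "smith_ideal g = Idl\<^bsub>free_algebra\<^esub> (smith_relations g)"

definition smith_algebra :: "'a poly \<Rightarrow> (smith_gen word \<Rightarrow>\<^sub>0 'a::comm_ring_1) set ring"
  where "smith_algebra g = free_algebra Quot smith_ideal g"

definition smith_class ::
  "'a poly \<Rightarrow> (smith_gen word \<Rightarrow>\<^sub>0 'a) \<Rightarrow> (smith_gen word \<Rightarrow>\<^sub>0 'a::comm_ring_1) set"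
  where "smith_class g a = smith_ideal g +>\<^bsub>free_algebra\<^esub> a"


section \<open>The modules \<open>A\<^sub>C(X)\<close>\<close>

definition A_q :: "'a::field multiset \<Rightarrow> 'a poly"
  where "A_q X = (\<Prod>\<alpha>\<in>#X. [:- \<alpha>, 1:])"

definition A_p :: "'a::field poly \<Rightarrow> 'a \<Rightarrow> 'a multiset \<Rightarrow> 'a poly"
  where "A_p u C X = ((u + [:C:]) \<circ>\<^sub>p [:- 1, 1:]) div (A_q X \<circ>\<^sub>p [:- 1, 1:])"

fun gen_act :: "'a::field poly \<Rightarrow> 'a poly \<Rightarrow> smith_gen \<Rightarrow> 'a poly \<Rightarrow> 'a poly"
  where
    "gen_act q p GX f = (f \<circ>\<^sub>p [:1, 1:]) * q"
  | "gen_act q p GY f = (f \<circ>\<^sub>p [:- 1, 1:]) * p"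
  | "gen_act q p GH f = [:0, 1:] * f"

definition word_act :: "'a::field poly \<Rightarrow> 'a poly \<Rightarrow> smith_gen word \<Rightarrow> 'a poly \<Rightarrow> 'a poly"
  where "word_act q p w f = foldr (gen_act q p) (letters w) f"

definition free_act ::
  "'a::field poly \<Rightarrow> 'a poly \<Rightarrow> (smith_gen word \<Rightarrow>\<^sub>0 'a) \<Rightarrow> 'a poly \<Rightarrow> 'a poly"
  where "free_act q p a f =
    (\<Sum>w\<in>Poly_Mapping.keys a. Polynomial.smult (Poly_Mapping.lookup a w) (word_act q p w f))"

text \<open>
  An element \<open>s\<close> of the Smith algebra is a coset in the free algebra; all its elements act in the
  same way (lemma \<open>A_module_smult\<close> below). The fields \<^const>\<open>mult\<close> and \<^const>\<open>one\<close> of the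
  library's module record play no role.
\<close>

definition A_module ::
  "'a::field poly \<Rightarrow> 'a \<Rightarrow> 'a multiset \<Rightarrow> ((smith_gen word \<Rightarrow>\<^sub>0 'a) set, 'a poly) module"
  where "A_module u C X =
    \<lparr>carrier = UNIV, mult = (*), one = 1, zero = 0, add = (+),
     smult = (\<lambda>s f. the_elem ((\<lambda>a. free_act (A_q X) (A_p u C X) a f) ` s))\<rparr>"


section \<open>The combinatorial function\<close>

definition int_le :: "'a::ring_1 \<Rightarrow> 'a \<Rightarrow> bool"
  where "int_le \<alpha> \<beta> \<longleftrightarrow> (\<exists>n::nat. \<beta> - \<alpha> = of_nat n)"

definition int_less :: "'a::ring_1 \<Rightarrow> 'a \<Rightarrow> bool"
  where "int_less \<alpha> \<beta> \<longleftrightarrow> int_le \<alpha> \<beta> \<and> \<alpha> \<noteq> \<beta>"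

definition phi :: "'a::ring_1 multiset \<Rightarrow> 'a multiset \<Rightarrow> 'a \<Rightarrow> nat"
  where "phi R Z \<beta> =
    min (size {#\<alpha> \<in># R - Z. int_less \<alpha> \<beta>#}) (size {#\<alpha> \<in># Z. int_le \<beta> \<alpha>#})"


section \<open>Well-definedness\<close>

lemma free_algebra_ring: "ring (free_algebra :: ('g word \<Rightarrow>\<^sub>0 'a::comm_ring_1) ring)"
proof (rule ringI)
  show "abelian_group (free_algebra :: ('g word \<Rightarrow>\<^sub>0 'a) ring)"
  proof (rule abelian_groupI)
    fix x :: "'g word \<Rightarrow>\<^sub>0 'a"
    show "\<exists>y\<in>carrier free_algebra. y \<oplus>\<^bsub>free_algebra\<^esub> x = \<zero>\<^bsub>free_algebra\<^esub>"
      by (rule bexI[of _ "- x"]) (simp_all add: free_algebra_def)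
  qed (simp_all add: free_algebra_def algebra_simps)
  show "Group.monoid (free_algebra :: ('g word \<Rightarrow>\<^sub>0 'a) ring)"
    by (rule Group.monoidI) (simp_all add: free_algebra_def algebra_simps)
qed (simp_all add: free_algebra_def algebra_simps)

lemma smith_ideal_ideal: "ideal (smith_ideal g) free_algebra"
  unfolding smith_ideal_def
  by (rule ring.genideal_ideal[OF free_algebra_ring]) (simp add: free_algebra_def)

lemma smith_algebra_ring: "ring (smith_algebra g)"
  unfolding smith_algebra_def by (rule ideal.quotient_is_ring[OF smith_ideal_ideal])

lemma gen_act_add: "gen_act q p c (f + f') = gen_act q p c f + gen_act q p c f'"
  by (cases c) (simp_all add: pcompose_add algebra_simps)

lemma gen_act_smult:
  "gen_act q p c (Polynomial.smult k f) = Polynomial.smult k (gen_act q p c f)"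
  by (cases c) (simp_all add: pcompose_smult)

lemma word_act_add: "word_act q p w (f + f') = word_act q p w f + word_act q p w f'"
proof -
  have "foldr (gen_act q p) l (f + f') = foldr (gen_act q p) l f + foldr (gen_act q p) l f'" for l
    by (induction l) (simp_all add: gen_act_add)
  then show ?thesis by (simp add: word_act_def)
qed

lemma word_act_smult:
  "word_act q p w (Polynomial.smult k f) = Polynomial.smult k (word_act q p w f)"
proof -
  have "foldr (gen_act q p) l (Polynomial.smult k f) =
      Polynomial.smult k (foldr (gen_act q p) l f)" for l
    by (induction l) (simp_all add: gen_act_smult)
  then show ?thesis by (simp add: word_act_def)
qed

lemma word_act_plus: "word_act q p (v + w) f = word_act q p v (word_act q p w f)"
  by (simp add: word_act_def plus_word_def)

lemma word_act_zero: "word_act q p 0 f = f"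
  by (simp add: word_act_def zero_word_def)

lemma free_act_superset:
  assumes "finite S" "Poly_Mapping.keys a \<subseteq> S"
  shows "free_act q p a f =
    (\<Sum>w\<in>S. Polynomial.smult (Poly_Mapping.lookup a w) (word_act q p w f))"
  unfolding free_act_def
  by (rule sum.mono_neutral_left) (use assms in \<open>auto simp: in_keys_iff\<close>)

lemma free_act_plus: "free_act q p (a + b) f = free_act q p a f + free_act q p b f"
proof -
  let ?S = "Poly_Mapping.keys a \<union> Poly_Mapping.keys b"
  have fin: "finite ?S" by simp
  show ?thesis
    using free_act_superset[OF fin, of a q p f] free_act_superset[OF fin, of b q p f]
      free_act_superset[OF fin Poly_Mapping.keys_add, of q p f]
    by (simp add: lookup_add smult_add_left sum.distrib)
qed

lemma free_act_0: "free_act q p 0 f = 0"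
  by (simp add: free_act_def)

lemma free_act_uminus: "free_act q p (- a) f = - free_act q p a f"
  using free_act_plus[of q p a "- a" f] by (simp add: free_act_0 eq_neg_iff_add_eq_0 add.commute)

lemma free_act_minus: "free_act q p (a - b) f = free_act q p a f - free_act q p b f"
  using free_act_plus[of q p a "- b" f] by (simp add: free_act_uminus)

lemma free_act_sum: "free_act q p (sum F S) f = (\<Sum>i\<in>S. free_act q p (F i) f)"
  by (induction S rule: infinite_finite_induct) (simp_all add: free_act_0 free_act_plus)

lemma free_act_single:
  "free_act q p (Poly_Mapping.single w c) f = Polynomial.smult c (word_act q p w f)"
  by (simp add: free_act_def)

lemma free_act_add: "free_act q p a (f + f') = free_act q p a f + free_act q p a f'"
  by (simp add: free_act_def word_act_add smult_add_right sum.distrib)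

lemma free_act_smult:
  "free_act q p a (Polynomial.smult k f) = Polynomial.smult k (free_act q p a f)"
proof -
  have "Polynomial.smult k (sum F S) = (\<Sum>w\<in>S. Polynomial.smult k (F w))"
    for F :: "smith_gen word \<Rightarrow> 'a poly" and S
    by (induction S rule: infinite_finite_induct) (simp_all add: smult_add_right)
  then show ?thesis
    by (simp add: free_act_def word_act_smult mult.commute)
qed

lemma free_act_zero_right: "free_act q p a 0 = 0"
  using free_act_smult[of q p a 0 0] by simp

lemma free_act_one: "free_act q p 1 f = f"
  using free_act_single[of q p 0 1 f] by (simp add: word_act_zero single_one)

lemma poly_mapping_single_induct [case_names single sum]:
  fixes a :: "'w \<Rightarrow>\<^sub>0 'b::monoid_add"
  assumes single: "\<And>w d. P (Poly_Mapping.single w d)"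
    and sum: "\<And>a b. P a \<Longrightarrow> P b \<Longrightarrow> P (a + b)"
  shows "P a"
proof (induction a rule: update_induct)
  case const
  then show ?case using single[of _ 0] by simp
next
  case (update a w d)
  then have "Poly_Mapping.update w d a = Poly_Mapping.single w d + a"
    by (intro poly_mapping_eqI) (auto simp: lookup_update lookup_add lookup_single in_keys_iff when_def)
  with update show ?case by (simp add: single sum)
qed

lemma free_act_single_mult:
  "free_act q p (Poly_Mapping.single v c * b) f =
    free_act q p (Poly_Mapping.single v c) (free_act q p b f)"
proof (induction b rule: poly_mapping_single_induct)
  case (single w d)
  then show ?case
    by (simp add: mult_single free_act_single word_act_plus word_act_smult)
next
  case (sum b b')
  then show ?case
    by (simp add: distrib_left free_act_plus free_act_add)
qed

lemma free_act_mult: "free_act q p (a * b) f = free_act q p a (free_act q p b f)"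
proof (induction a rule: poly_mapping_single_induct)
  case (single w d)
  then show ?case by (rule free_act_single_mult)
next
  case (sum a a')
  then show ?case
    by (simp add: distrib_right free_act_plus)
qed

lemma free_act_gen: "free_act q p (free_gen c) f = gen_act q p c f"
  by (simp add: free_gen_def free_act_single word_act_def)

lemma free_act_scalar: "free_act q p (free_scalar c) f = Polynomial.smult c f"
  by (simp add: free_scalar_def free_act_single word_act_zero)

lemma free_act_eval_GH: "free_act q p (free_eval g (free_gen GH)) f = g * f"
proof -
  have pow: "free_act q p (free_gen GH ^ i) f = [:0, 1:] ^ i * f" for i
    by (induction i) (simp_all add: free_act_one free_act_mult free_act_gen algebra_simps)
  have "free_act q p (free_eval g (free_gen GH)) f =
      (\<Sum>i\<le>Polynomial.degree g. Polynomial.smult (Polynomial.coeff g i) ([:0, 1:] ^ i)) * f"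
    by (simp add: free_eval_def free_act_sum free_act_mult free_act_scalar pow sum_distrib_right)
  also have "(\<Sum>i\<le>Polynomial.degree g. Polynomial.smult (Polynomial.coeff g i) ([:0, 1:] ^ i)) = g"
    by (simp add: poly_as_sum_of_monoms flip: monom_altdef)
  finally show ?thesis .
qed

lemma A_q_dvd:
  assumes "X \<subseteq># proots f"
  shows "A_q X dvd f"
proof (cases "f = 0")
  case False
  then show ?thesis
    using assms
  proof (induction X arbitrary: f)
    case empty
    then show ?case by (simp add: A_q_def)
  next
    case (add \<alpha> X)
    from add.prems have "\<alpha> \<in># proots f" by (auto dest: mset_subset_eqD)
    with add.prems obtain f' where f': "f = [:- \<alpha>, 1:] * f'"
      by (auto simp: poly_eq_0_iff_dvd elim: dvdE)
    with add.prems have "f' \<noteq> 0" by auto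
    then have "proots f = add_mset \<alpha> (proots f')"
      unfolding f' by (subst proots_mult) auto
    with add.prems \<open>f' \<noteq> 0\<close> have "A_q X dvd f'" by (intro add.IH) auto
    then have "[:- \<alpha>, 1:] * A_q X dvd [:- \<alpha>, 1:] * f'" by (intro mult_dvd_mono dvd_refl)
    then show ?case by (simp only: A_q_def f' image_mset_add_mset prod_mset.add_mset)
  qed
qed simp

lemma A_p_mult:
  assumes "X \<subseteq># proots (u + [:C:])"
  shows "A_p u C X * (A_q X \<circ>\<^sub>p [:- 1, 1:]) = (u + [:C:]) \<circ>\<^sub>p [:- 1, 1:]"
proof -
  from A_q_dvd[OF assms] obtain r where "u + [:C:] = A_q X * r" by (elim dvdE)
  then have "(A_q X \<circ>\<^sub>p [:- 1, 1:]) dvd ((u + [:C:]) \<circ>\<^sub>p [:- 1, 1:])"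
    by (simp add: pcompose_mult)
  then show ?thesis by (simp add: A_p_def)
qed

lemma pcompose_shifts:
  fixes f :: "'a::field poly"
  shows "f \<circ>\<^sub>p [:1, 1:] \<circ>\<^sub>p [:- 1, 1:] = f" "f \<circ>\<^sub>p [:- 1, 1:] \<circ>\<^sub>p [:1, 1:] = f"
  by (simp_all add: pcompose_pCons flip: pcompose_assoc)

lemma smith_relations_act:
  fixes g u :: "'a::field poly"
  assumes X: "X \<subseteq># proots (u + [:C:])" and g: "g = u \<circ>\<^sub>p [:- 1, 1:] - u"
    and r: "r \<in> smith_relations g"
  shows "free_act (A_q X) (A_p u C X) r f = 0"
proof -
  have pq: "A_p u C X * (A_q X \<circ>\<^sub>p [:- 1, 1:]) = u \<circ>\<^sub>p [:- 1, 1:] + [:C:]"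
    using A_p_mult[OF X] by (simp add: pcompose_add)
  have "(A_p u C X * (A_q X \<circ>\<^sub>p [:- 1, 1:])) \<circ>\<^sub>p [:1, 1:] = u + [:C:]"
    by (simp add: pq pcompose_add pcompose_shifts)
  then have qp: "(A_p u C X \<circ>\<^sub>p [:1, 1:]) * A_q X = u + [:C:]"
    by (simp add: pcompose_mult pcompose_shifts)
  have yx: "f * (A_q X \<circ>\<^sub>p [:- 1, 1:]) * A_p u C X = f * (u \<circ>\<^sub>p [:- 1, 1:] + [:C:])"
    by (simp add: mult_ac flip: pq)
  have xy: "f * (A_p u C X \<circ>\<^sub>p [:1, 1:]) * A_q X = f * (u + [:C:])"
    by (simp add: mult_ac flip: qp)
  have s1: "[:1, 1:] = [:0, 1:] + (1 :: 'a poly)" "[:- 1, 1:] = [:0, 1:] - (1 :: 'a poly)"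
    by (simp_all add: one_pCons)
  from r consider
      "r = (free_gen GH * free_gen GY - free_gen GY * free_gen GH) - free_gen GY"
    | "r = (free_gen GH * free_gen GX - free_gen GX * free_gen GH) - (- free_gen GX)"
    | "r = (free_gen GY * free_gen GX - free_gen GX * free_gen GY) - free_eval g (free_gen GH)"
    unfolding smith_relations_def Let_def by blast
  then show ?thesis
  proof cases
    case 1
    have "[:0, 1:] \<circ>\<^sub>p [:- 1, 1:] = ([:0, 1:] - 1 :: 'a poly)"
      by (simp add: pcompose_pCons one_pCons)
    then show ?thesis unfolding 1
      by (simp only: free_act_minus free_act_mult free_act_gen gen_act.simps pcompose_mult)
        (simp only: algebra_simps, simp)
  next
    case 2
    have "[:0, 1:] \<circ>\<^sub>p [:1, 1:] = ([:0, 1:] + 1 :: 'a poly)"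
      by (simp add: pcompose_pCons one_pCons)
    then show ?thesis unfolding 2
      by (simp only: free_act_minus free_act_uminus free_act_mult free_act_gen gen_act.simps
          pcompose_mult) (simp only: algebra_simps, simp)
  next
    case 3
    show ?thesis unfolding 3
      by (simp only: free_act_minus free_act_mult free_act_gen gen_act.simps free_act_eval_GH
          pcompose_mult pcompose_shifts yx xy g) (simp only: algebra_simps, simp)
  qed
qed

lemma smith_ideal_act:
  fixes g u :: "'a::field poly"
  assumes X: "X \<subseteq># proots (u + [:C:])" and g: "g = u \<circ>\<^sub>p [:- 1, 1:] - u"
    and a: "a \<in> smith_ideal g"
  shows "free_act (A_q X) (A_p u C X) a f = 0"
proof -
  let ?F = "free_algebra :: (smith_gen word \<Rightarrow>\<^sub>0 'a) ring"
  let ?act = "free_act (A_q X) (A_p u C X)"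
  interpret ring ?F by (rule free_algebra_ring)
  define K where "K = {a. \<forall>f. ?act a f = 0}"
  have "ideal K ?F"
  proof (rule idealI)
    show "subgroup K (add_monoid ?F)"
    proof (rule add.subgroupI)
      show "\<ominus>\<^bsub>?F\<^esub> a \<in> K" if "a \<in> K" for a
      proof -
        have "\<ominus>\<^bsub>?F\<^esub> a = - a"
          by (rule minus_equality) (simp_all add: free_algebra_def)
        then show ?thesis using that by (simp add: K_def free_act_uminus)
      qed
      show "K \<noteq> {}" using free_act_0 by (auto simp: K_def)
    qed (auto simp: free_algebra_def K_def free_act_plus)
  qed (use ring_axioms in \<open>auto simp: free_algebra_def K_def free_act_mult free_act_zero_right\<close>)
  moreover have "smith_relations g \<subseteq> K"
    using smith_relations_act[OF X g] by (auto simp: K_def)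
  ultimately have "smith_ideal g \<subseteq> K"
    unfolding smith_ideal_def by (rule genideal_minimal)
  with a show ?thesis by (auto simp: K_def)
qed

lemma smith_algebra_carrier: "carrier (smith_algebra g) = range (smith_class g)"
  by (auto simp: smith_algebra_def FactRing_def A_RCOSETS_def' a_r_coset_def' RCOSETS_def
      smith_class_def free_algebra_def)

lemma A_module_smult:
  assumes X: "X \<subseteq># proots (u + [:C:])" and g: "g = u \<circ>\<^sub>p [:- 1, 1:] - u"
  shows "smith_class g a \<odot>\<^bsub>A_module u C X\<^esub> f = free_act (A_q X) (A_p u C X) a f"
proof -
  interpret ideal "smith_ideal g" free_algebra by (rule smith_ideal_ideal)
  have coset: "smith_class g a = {i + a | i. i \<in> smith_ideal g}"
    by (auto simp: smith_class_def a_r_coset_def' free_algebra_def)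
  have "(0 :: smith_gen word \<Rightarrow>\<^sub>0 'a) \<in> smith_ideal g"
    using additive_subgroup.zero_closed[OF is_additive_subgroup] by (simp add: free_algebra_def)
  then have "(\<lambda>b. free_act (A_q X) (A_p u C X) b f) ` smith_class g a =
      {free_act (A_q X) (A_p u C X) a f}"
    unfolding coset by (force simp: free_act_plus smith_ideal_act[OF X g])
  then show ?thesis by (simp add: A_module_def)
qed

lemma A_module_gen_act:
  assumes "X \<subseteq># proots (u + [:C:])" and "g = u \<circ>\<^sub>p [:- 1, 1:] - u"
  shows "smith_class g (free_gen GX) \<odot>\<^bsub>A_module u C X\<^esub> f = (f \<circ>\<^sub>p [:1, 1:]) * A_q X"
    and "smith_class g (free_gen GY) \<odot>\<^bsub>A_module u C X\<^esub> f = (f \<circ>\<^sub>p [:- 1, 1:]) * A_p u C X"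
    and "smith_class g (free_gen GH) \<odot>\<^bsub>A_module u C X\<^esub> f = [:0, 1:] * f"
    and "smith_class g (free_scalar c) \<odot>\<^bsub>A_module u C X\<^esub> f = Polynomial.smult c f"
  by (simp_all only: A_module_smult[OF assms] free_act_gen free_act_scalar gen_act.simps)

theorem A_module_left_module:
  assumes X: "X \<subseteq># proots (u + [:C:])" and g: "g = u \<circ>\<^sub>p [:- 1, 1:] - u"
  shows "left_module (smith_algebra g) (A_module u C X)"
proof -
  interpret I: ideal "smith_ideal g" free_algebra by (rule smith_ideal_ideal)
  have hom: "smith_class g \<in> ring_hom free_algebra (smith_algebra g)"
    using I.rcos_ring_hom by (simp add: smith_algebra_def smith_class_def[abs_def])
  have plus: "smith_class g a \<oplus>\<^bsub>smith_algebra g\<^esub> smith_class g b = smith_class g (a + b)" for a b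
    using ring_hom_add[OF hom, of a b] by (simp add: free_algebra_def)
  have times: "smith_class g a \<otimes>\<^bsub>smith_algebra g\<^esub> smith_class g b = smith_class g (a * b)" for a b
    using ring_hom_mult[OF hom, of a b] by (simp add: free_algebra_def)
  have one: "\<one>\<^bsub>smith_algebra g\<^esub> = smith_class g 1"
    using ring_hom_one[OF hom] by (simp add: free_algebra_def)
  have M: "carrier (A_module u C X) = UNIV" "f \<oplus>\<^bsub>A_module u C X\<^esub> f' = f + f'"
      "\<zero>\<^bsub>A_module u C X\<^esub> = 0" for f f'
    by (simp_all add: A_module_def)
  have "abelian_group (A_module u C X)"
  proof (rule abelian_groupI)
    fix x :: "'a poly"
    show "\<exists>y\<in>carrier (A_module u C X). y \<oplus>\<^bsub>A_module u C X\<^esub> x = \<zero>\<^bsub>A_module u C X\<^esub>"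
      by (rule bexI[of _ "- x"]) (simp_all add: M)
  qed (simp_all add: M add_ac)
  then show ?thesis
    by (intro left_module.intro smith_algebra_ring left_module_axioms.intro)
      (auto simp: smith_algebra_carrier M plus times one A_module_smult[OF X g]
        free_act_plus free_act_add free_act_mult free_act_one)
qed

end

theory Submission
  imports Defs
begin

text \<open>
  Write \<open>R\<close> for the multiset of roots of \<open>u + C\<close> and \<open>P = R - X\<close>. A submodule of \<open>A\<^sub>C(X)\<close> is an ideal of
  the polynomial ring that is stable under \<open>x\<close> and \<open>y\<close> (\<open>submodule_A_module_iff\<close>). A nonzero ideal is
  generated by a unique monic polynomial, that is, it is given by a finite multiset \<open>M\<close> of scalars, and
  inclusion of ideals is reverse inclusion of multisets. As \<open>x\<close> shifts by one and multiplies by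
  \<open>q\<close>, whose roots are \<open>X\<close>, and \<open>y\<close> shifts back and multiplies by \<open>p\<close>, whose roots are \<open>P\<close> moved up by
  one, stability means that at every \<open>\<beta>\<close> the step \<open>count M (\<beta> + 1) - count M \<beta>\<close> is at least
  \<open>- count X \<beta>\<close> and at most \<open>count P \<beta>\<close>. Such multisets are called balanced
  (\<open>submodule_A_ideal_iff\<close>, \<open>submodule_A_module_cases\<close>).

  The length is thus one more than the greatest length of a chain of balanced multisets, the extra
  step being the one from the zero submodule to the smallest nonzero one. Since \<open>M\<close> is finite, it
  vanishes far down and far up in every coset of the integers; summing the allowed rises from
  below and the allowed descents from above gives \<open>count M \<beta> \<le> phi R X \<beta>\<close>
  (\<open>balanced_count_le_phi\<close>), and \<open>phi R X\<close> is itself balanced (\<open>ex_balanced_phi\<close>). So the chains run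
  between the empty multiset and \<open>phi R X\<close>.

  A balanced multiset can only change its value right after a point of \<open>R\<close>. It is therefore determined
  by its values on \<open>R\<close>, and the weight, the sum of these values over the distinct points of \<open>R\<close>,
  increases along strict inclusions (\<open>weight_less\<close>). Conversely, every nonempty balanced
  multiset contains one whose weight is smaller by exactly one (\<open>balanced_step_down\<close>). Hence the
  longest chains have as many steps as the weight of \<open>phi R X\<close>, which is the sum in the theorem.
\<close>

section \<open>Finite sets and integer shifts\<close>

text \<open>In characteristic zero a coset of the integers is an infinite chain, so a finite set has a
  lowest element in every coset it meets. Consequently it cannot be closed under a unit shift, which
  replaces induction along the chain in most of the arguments below.\<close>

lemma ex_lowest_in_coset:
  fixes S :: "'a::ring_char_0 set"
  assumes "finite S" and "\<gamma> \<in> S"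
  obtains \<beta> where "\<beta> \<in> S" and "\<And>k. \<beta> - of_nat (Suc k) \<notin> S"
proof -
  define K where "K = {n. \<gamma> - of_nat n \<in> S}"
  have "inj (\<lambda>n. \<gamma> - of_nat n :: 'a)"
    by (auto intro: injI)
  then have "finite K"
    using finite_vimageI[OF assms(1)] by (simp add: K_def vimage_def)
  moreover have "0 \<in> K"
    using assms(2) by (simp add: K_def)
  ultimately have Max: "Max K \<in> K" "\<And>n. n \<in> K \<Longrightarrow> n \<le> Max K"
    by (auto intro: Max_in)
  have "\<gamma> - of_nat (Max K) - of_nat (Suc k) \<notin> S" for k
    using Max(2)[of "Max K + Suc k"] by (auto simp: K_def algebra_simps)
  with Max(1) show thesis
    by (intro that[of "\<gamma> - of_nat (Max K)"]) (auto simp: K_def)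
qed

lemma finite_shift_closed_down_empty:
  fixes S :: "'a::ring_char_0 set"
  assumes "finite S" and "\<And>\<beta>. \<beta> \<in> S \<Longrightarrow> \<beta> - 1 \<in> S"
  shows "S = {}"
proof (rule ccontr)
  assume "S \<noteq> {}"
  then obtain \<gamma> where "\<gamma> \<in> S"
    by blast
  then obtain \<beta> where "\<beta> \<in> S" and low: "\<And>k. \<beta> - of_nat (Suc k) \<notin> S"
    using ex_lowest_in_coset[OF assms(1)] by blast
  then show False
    using assms(2)[of \<beta>] low[of 0] by simp
qed

lemma finite_shift_closed_up_empty:
  fixes S :: "'a::ring_char_0 set"
  assumes "finite S" and "\<And>\<beta>. \<beta> \<in> S \<Longrightarrow> \<beta> + 1 \<in> S"
  shows "S = {}"
proof -
  have "uminus ` S = {}"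
  proof (rule finite_shift_closed_down_empty)
    show "\<beta> - 1 \<in> uminus ` S" if "\<beta> \<in> uminus ` S" for \<beta>
    proof -
      from that obtain \<gamma> where "\<gamma> \<in> S" "\<beta> = - \<gamma>"
        by blast
      then show ?thesis
        using assms(2)[of \<gamma>] by (intro image_eqI[of _ _ "\<gamma> + 1"]) auto
    qed
  qed (use assms(1) in simp)
  then show ?thesis
    by simp
qed

section \<open>Balanced multisets\<close>

text \<open>If \<open>q\<close> has root multiset \<open>Q\<close> and \<open>p(h + 1)\<close> has root multiset \<open>P\<close>, then the two
  inequalities say that the monic polynomial with root multiset \<open>M\<close> generates an ideal stable under
  \<open>x\<close> and \<open>y\<close> respectively.\<close>

definition balanced :: "'a::ring_1 multiset \<Rightarrow> 'a multiset \<Rightarrow> 'a multiset \<Rightarrow> bool"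
  where "balanced Q P M \<longleftrightarrow>
    (\<forall>\<beta>. count M \<beta> \<le> count M (\<beta> + 1) + count Q \<beta> \<and> count M (\<beta> + 1) \<le> count M \<beta> + count P \<beta>)"

lemma balancedD:
  assumes "balanced Q P M"
  shows "count M \<beta> \<le> count M (\<beta> + 1) + count Q \<beta>"
    and "count M (\<beta> + 1) \<le> count M \<beta> + count P \<beta>"
  using assms by (auto simp: balanced_def)

lemma balanced_const:
  assumes "balanced Q P M" and "\<beta> \<notin># Q + P"
  shows "count M (\<beta> + 1) = count M \<beta>"
  using balancedD[OF assms(1), of \<beta>] assms(2) by (simp add: not_in_iff)

text \<open>The next two lemmas are the recursions of the two cardinalities in \<^const>\<open>phi\<close> along a coset.
  Each is the extremal case of one of the inequalities that define a balanced multiset.\<close>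

lemma size_filter_less_plus_1:
  fixes P :: "'a::ring_char_0 multiset"
  shows "size {#\<alpha> \<in># P. int_less \<alpha> (\<beta> + 1)#} = size {#\<alpha> \<in># P. int_less \<alpha> \<beta>#} + count P \<beta>"
proof -
  have iff: "int_less \<alpha> (\<beta> + 1) \<longleftrightarrow> int_less \<alpha> \<beta> \<or> \<alpha> = \<beta>" for \<alpha> :: 'a
  proof
    assume "int_less \<alpha> (\<beta> + 1)"
    then obtain n where n: "\<beta> + 1 - \<alpha> = of_nat n" "\<alpha> \<noteq> \<beta> + 1"
      by (auto simp: int_less_def int_le_def)
    then have "n \<noteq> 0"
      by (intro notI) simp
    then obtain k where "n = Suc k"
      by (cases n) auto
    with n have "\<beta> - \<alpha> = of_nat k"
      by (simp add: algebra_simps)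
    then show "int_less \<alpha> \<beta> \<or> \<alpha> = \<beta>"
      by (auto simp: int_less_def int_le_def)
  next
    assume "int_less \<alpha> \<beta> \<or> \<alpha> = \<beta>"
    then obtain n where "\<beta> - \<alpha> = of_nat n"
      by (auto simp: int_less_def int_le_def intro: that[of 0])
    then have n: "\<beta> + 1 - \<alpha> = of_nat (Suc n)"
      by (simp add: algebra_simps)
    moreover have "\<alpha> \<noteq> \<beta> + 1"
    proof
      assume "\<alpha> = \<beta> + 1"
      then have "\<beta> + 1 - \<alpha> = 0"
        by simp
      then show False
        using n of_nat_neq_0[of n, where 'a = 'a] by metis
    qed
    ultimately show "int_less \<alpha> (\<beta> + 1)"
      unfolding int_less_def int_le_def by blast
  qed
  have "{#\<alpha> \<in># P. int_less \<alpha> (\<beta> + 1)#} =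
      {#\<alpha> \<in># P. int_less \<alpha> \<beta>#} + replicate_mset (count P \<beta>) \<beta>"
    unfolding iff by (rule multiset_eqI) (auto simp: int_less_def)
  then show ?thesis
    by simp
qed

lemma size_filter_ge_plus_1:
  fixes Q :: "'a::ring_char_0 multiset"
  shows "size {#\<alpha> \<in># Q. int_le \<beta> \<alpha>#} = size {#\<alpha> \<in># Q. int_le (\<beta> + 1) \<alpha>#} + count Q \<beta>"
proof -
  have not_le: "\<not> int_le (\<beta> + 1) \<beta>"
  proof
    assume "int_le (\<beta> + 1) \<beta>"
    then obtain n where "\<beta> - (\<beta> + 1) = of_nat n"
      by (auto simp: int_le_def)
    then have "of_nat (Suc n) = 1 + (\<beta> - (\<beta> + 1))"
      by (simp only: of_nat_Suc)
    also have "\<dots> = 0"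
      by simp
    finally show False
      using of_nat_neq_0 by blast
  qed
  have iff: "int_le \<beta> \<alpha> \<longleftrightarrow> int_le (\<beta> + 1) \<alpha> \<or> \<alpha> = \<beta>" for \<alpha> :: 'a
  proof
    assume "int_le \<beta> \<alpha>"
    then obtain n where n: "\<alpha> - \<beta> = of_nat n"
      by (auto simp: int_le_def)
    show "int_le (\<beta> + 1) \<alpha> \<or> \<alpha> = \<beta>"
    proof (cases n)
      case (Suc k)
      with n have "\<alpha> - (\<beta> + 1) = of_nat k"
        by (simp add: algebra_simps)
      then show ?thesis
        by (auto simp: int_le_def)
    qed (use n in simp)
  next
    assume "int_le (\<beta> + 1) \<alpha> \<or> \<alpha> = \<beta>"
    then show "int_le \<beta> \<alpha>"
    proof
      assume "int_le (\<beta> + 1) \<alpha>"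
      then obtain n where "\<alpha> - (\<beta> + 1) = of_nat n"
        by (auto simp: int_le_def)
      then have "\<alpha> - \<beta> = of_nat (Suc n)"
        by (simp add: algebra_simps)
      then show ?thesis
        unfolding int_le_def by blast
    qed (auto simp: int_le_def intro: exI[of _ 0])
  qed
  have "{#\<alpha> \<in># Q. int_le \<beta> \<alpha>#} =
      {#\<alpha> \<in># Q. int_le (\<beta> + 1) \<alpha>#} + replicate_mset (count Q \<beta>) \<beta>"
    by (rule multiset_eqI) (use not_le in \<open>auto simp: iff\<close>)
  then show ?thesis
    by simp
qed

text \<open>If \<open>M\<close> exceeded \<open>size {#\<alpha> \<in># P. int_less \<alpha> \<beta>#}\<close> at \<open>\<beta>\<close>, it would do so at \<open>\<beta> - 1\<close> as well, because going down by one lowers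
  the bound by \<open>count P (\<beta> - 1)\<close> and the multiplicity by at most that much; but \<open>M\<close> is finite. The
  other bound is symmetric, going up.\<close>

lemma balanced_count_le_phi:
  fixes M :: "'a::ring_char_0 multiset"
  assumes "balanced Q P M"
  shows "count M \<beta> \<le> phi (Q + P) Q \<beta>"
proof -
  have "{\<beta>. size {#\<alpha> \<in># P. int_less \<alpha> \<beta>#} < count M \<beta>} = {}"
  proof (rule finite_shift_closed_down_empty)
    show "finite {\<beta>. size {#\<alpha> \<in># P. int_less \<alpha> \<beta>#} < count M \<beta>}"
      by (rule finite_subset[OF _ finite_set_mset[of M]])
        (auto intro: gr_implies_not0 simp flip: count_greater_zero_iff)
  next
    fix \<beta> assume "\<beta> \<in> {\<beta>. size {#\<alpha> \<in># P. int_less \<alpha> \<beta>#} < count M \<beta>}"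
    then show "\<beta> - 1 \<in> {\<beta>. size {#\<alpha> \<in># P. int_less \<alpha> \<beta>#} < count M \<beta>}"
      using balancedD(2)[OF assms, of "\<beta> - 1"] size_filter_less_plus_1[of "\<beta> - 1" P] by simp
  qed
  moreover have "{\<beta>. size {#\<alpha> \<in># Q. int_le \<beta> \<alpha>#} < count M \<beta>} = {}"
  proof (rule finite_shift_closed_up_empty)
    show "finite {\<beta>. size {#\<alpha> \<in># Q. int_le \<beta> \<alpha>#} < count M \<beta>}"
      by (rule finite_subset[OF _ finite_set_mset[of M]])
        (auto intro: gr_implies_not0 simp flip: count_greater_zero_iff)
  next
    fix \<beta> assume "\<beta> \<in> {\<beta>. size {#\<alpha> \<in># Q. int_le \<beta> \<alpha>#} < count M \<beta>}"
    then show "\<beta> + 1 \<in> {\<beta>. size {#\<alpha> \<in># Q. int_le \<beta> \<alpha>#} < count M \<beta>}"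
      using balancedD(1)[OF assms, of \<beta>] size_filter_ge_plus_1[of \<beta> Q] by simp
  qed
  ultimately show ?thesis
    by (auto simp: phi_def not_less set_eq_iff)
qed

text \<open>A point with \<open>phi > 0\<close> lies between an element of \<open>P\<close> and an element of \<open>Q\<close>, and intervals of
  \<^const>\<open>int_le\<close> are finite.\<close>

lemma finite_phi_support:
  fixes Q P :: "'a::ring_char_0 multiset"
  shows "finite {\<beta>. phi (Q + P) Q \<beta> > 0}"
proof (rule finite_subset)
  define between where "between \<alpha> \<gamma> = {\<beta>. int_le \<alpha> \<beta> \<and> int_le \<beta> \<gamma>}" for \<alpha> \<gamma> :: 'a
  show "{\<beta>. phi (Q + P) Q \<beta> > 0} \<subseteq> (\<Union>\<alpha>\<in>set_mset P. \<Union>\<gamma>\<in>set_mset Q. between \<alpha> \<gamma>)"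
  proof
    fix \<beta> assume "\<beta> \<in> {\<beta>. phi (Q + P) Q \<beta> > 0}"
    then have "{#\<alpha> \<in># P. int_less \<alpha> \<beta>#} \<noteq> {#}" "{#\<alpha> \<in># Q. int_le \<beta> \<alpha>#} \<noteq> {#}"
      by (auto simp: phi_def simp flip: nonempty_has_size)
    then obtain \<alpha> \<gamma> where "\<alpha> \<in># {#\<alpha> \<in># P. int_less \<alpha> \<beta>#}" "\<gamma> \<in># {#\<alpha> \<in># Q. int_le \<beta> \<alpha>#}"
      by (meson multiset_nonemptyE)
    then show "\<beta> \<in> (\<Union>\<alpha>\<in>set_mset P. \<Union>\<gamma>\<in>set_mset Q. between \<alpha> \<gamma>)"
      by (auto simp: between_def int_less_def)
  qed
  have "finite (between \<alpha> \<gamma>)" for \<alpha> \<gamma>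
  proof (cases "\<exists>N. \<gamma> - \<alpha> = of_nat N")
    case True
    then obtain N where N: "\<gamma> - \<alpha> = of_nat N"
      by blast
    have "between \<alpha> \<gamma> \<subseteq> (\<lambda>n. \<alpha> + of_nat n) ` {..N}"
    proof
      fix \<beta> assume "\<beta> \<in> between \<alpha> \<gamma>"
      then obtain m n where mn: "\<beta> - \<alpha> = of_nat m" "\<gamma> - \<beta> = of_nat n"
        by (auto simp: between_def int_le_def)
      then have "of_nat N = (of_nat (m + n) :: 'a)"
        using N by (simp add: algebra_simps flip: mn)
      then have "m \<le> N"
        by (simp only: of_nat_eq_iff)
      then show "\<beta> \<in> (\<lambda>n. \<alpha> + of_nat n) ` {..N}"
        using mn by (auto intro!: image_eqI[of _ _ m] simp flip: mn)
    qed
    then show ?thesis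
      by (rule finite_subset) simp
  next
    case False
    have "between \<alpha> \<gamma> = {}"
    proof (rule equals0I)
      fix \<beta> assume "\<beta> \<in> between \<alpha> \<gamma>"
      then obtain m n where mn: "\<beta> - \<alpha> = of_nat m" "\<gamma> - \<beta> = of_nat n"
        by (auto simp: between_def int_le_def)
      then have "\<gamma> - \<alpha> = of_nat (m + n)"
        by (simp add: algebra_simps flip: mn)
      with False show False
        by blast
    qed
    then show ?thesis
      by simp
  qed
  then show "finite (\<Union>\<alpha>\<in>set_mset P. \<Union>\<gamma>\<in>set_mset Q. between \<alpha> \<gamma>)"
    by simp
qed

text \<open>So \<^const>\<open>phi\<close> is the largest balanced multiset; it belongs to the smallest nonzero
  submodule.\<close>

lemma ex_balanced_phi:
  fixes Q P :: "'a::ring_char_0 multiset"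
  obtains M where "balanced Q P M" and "count M = phi (Q + P) Q"
proof
  have count: "count (Abs_multiset (phi (Q + P) Q)) = phi (Q + P) Q"
    using finite_phi_support[of Q P] by (simp add: Abs_multiset_inverse)
  then show "count (Abs_multiset (phi (Q + P) Q)) = phi (Q + P) Q" .
  show "balanced Q P (Abs_multiset (phi (Q + P) Q))"
    unfolding balanced_def count
  proof
    fix \<beta> :: 'a
    show "phi (Q + P) Q \<beta> \<le> phi (Q + P) Q (\<beta> + 1) + count Q \<beta> \<and>
        phi (Q + P) Q (\<beta> + 1) \<le> phi (Q + P) Q \<beta> + count P \<beta>"
      using size_filter_less_plus_1[of \<beta> P] size_filter_ge_plus_1[of \<beta> Q]
      by (auto simp: phi_def min_def)
  qed
qed

section \<open>Chains of balanced multisets\<close>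

definition weight :: "'a set \<Rightarrow> 'a multiset \<Rightarrow> nat"
  where "weight S M = (\<Sum>\<beta>\<in>S. count M \<beta>)"

text \<open>A balanced multiset is constant on each gap between consecutive points of \<open>Q + P\<close>, so a
  difference anywhere propagates upwards to the next point of \<open>Q + P\<close>; if there is no such point, it
  would propagate forever.\<close>

lemma weight_less:
  fixes M M' :: "'a::ring_char_0 multiset"
  assumes bal: "balanced Q P M" "balanced Q P M'" and less: "M \<subset># M'"
  shows "weight (set_mset (Q + P)) M < weight (set_mset (Q + P)) M'"
proof -
  have le: "count M \<beta> \<le> count M' \<beta>" for \<beta>
    using less by (simp add: mset_subset_eq_count subset_mset.less_imp_le)
  have "\<exists>\<beta>\<in>#Q + P. count M \<beta> < count M' \<beta>"
  proof (rule ccontr)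
    assume "\<not> ?thesis"
    then have eq: "\<beta> \<notin># Q + P" if "count M \<beta> < count M' \<beta>" for \<beta>
      using that by blast
    have "{\<beta>. count M \<beta> < count M' \<beta>} = {}"
    proof (rule finite_shift_closed_up_empty)
      show "finite {\<beta>. count M \<beta> < count M' \<beta>}"
        by (rule finite_subset[OF _ finite_set_mset[of M']])
        (auto intro: gr_implies_not0 simp flip: count_greater_zero_iff)
    next
      fix \<beta> assume "\<beta> \<in> {\<beta>. count M \<beta> < count M' \<beta>}"
      then show "\<beta> + 1 \<in> {\<beta>. count M \<beta> < count M' \<beta>}"
        using eq[of \<beta>] balanced_const[OF bal(1), of \<beta>] balanced_const[OF bal(2), of \<beta>] by auto
    qed
    then have "M' \<subseteq># M"
      by (auto intro!: mset_subset_eqI simp: not_less set_eq_iff)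
    with less show False
      by (simp add: subset_mset.less_le_not_le)
  qed
  then show ?thesis
    unfolding weight_def by (intro sum_strict_mono_ex1) (use le in auto)
qed

text \<open>Take the points of maximal multiplicity \<open>t\<close> and look for one after which \<open>M\<close> drops or at which \<open>P\<close>
  allows a rise: there the multiplicity may be lowered without violating the upper inequality.
  Choose \<open>\<beta>\<close> lowest with this property, and lower \<open>M\<close> by one on the whole block \<open>D\<close> that consists of
  \<open>\<beta>\<close> and the gap of \<open>Q + P\<close> right below it, on which \<open>M\<close> is constant. Right below \<open>D\<close> lies a point
  \<open>\<delta>\<close> of \<open>Q + P\<close>. If \<open>M\<close> also takes the value \<open>t\<close> at \<open>\<delta>\<close>, the choice of \<open>\<beta>\<close> forces \<open>\<delta>\<close> to lie outside \<open>P\<close>,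
  hence in \<open>Q\<close>, and so a descent from \<open>\<delta>\<close> to \<open>\<delta> + 1\<close> is allowed. As \<open>\<beta>\<close> is the only point of \<open>Q + P\<close> in
  \<open>D\<close>, the weight goes down by exactly one.\<close>

lemma balanced_step_down:
  fixes M :: "'a::ring_char_0 multiset"
  assumes bal: "balanced Q P M" and "M \<noteq> {#}"
  obtains M' where "balanced Q P M'" and "M' \<subset># M"
    and "weight (set_mset (Q + P)) M = Suc (weight (set_mset (Q + P)) M')"
proof -
  define t where "t = Max (count M ` set_mset M)"
  have "t \<in> count M ` set_mset M"
    unfolding t_def using assms(2) by (intro Max_in) auto
  then have t: "t > 0" "\<exists>\<beta>. count M \<beta> = t"
    by auto
  have le_t: "count M \<beta> \<le> t" for \<beta>
    by (cases "\<beta> \<in># M") (auto simp: t_def not_in_iff intro: Max_ge)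
  have fin: "finite {\<beta>. count M \<beta> = t}"
    by (rule finite_subset[OF _ finite_set_mset[of M]]) (use t(1) in \<open>auto simp flip: count_greater_zero_iff\<close>)
  define T where "T = {\<beta>. count M \<beta> = t \<and> (count M (\<beta> + 1) < t \<or> \<beta> \<in># P)}"
  have "finite T"
    by (rule finite_subset[OF _ fin]) (auto simp: T_def)
  moreover have "T \<noteq> {}"
  proof
    assume "T = {}"
    then have "{\<beta>. count M \<beta> = t} = {}"
      using le_t by (intro finite_shift_closed_up_empty[OF fin]) (force simp: T_def order.order_iff_strict)
    with t(2) show False
      by blast
  qed
  ultimately obtain \<beta> where "\<beta> \<in> T" and lowest: "\<And>k. \<beta> - of_nat (Suc k) \<notin> T"
    using ex_lowest_in_coset[of T] by blast
  then have \<beta>: "count M \<beta> = t" "count M (\<beta> + 1) < t \<or> \<beta> \<in># P"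
    by (auto simp: T_def)
  have \<beta>_supp: "\<beta> \<in># Q + P"
    using balanced_const[OF bal, of \<beta>] \<beta> by force
  \<comment> \<open>Otherwise \<open>M\<close> would be equal to \<open>t > 0\<close> on the infinite chain below \<open>\<beta>\<close>.\<close>
  have "\<exists>k. \<beta> - of_nat (Suc k) \<in># Q + P"
  proof (rule ccontr)
    assume *: "\<not> ?thesis"
    have "count M (\<beta> - of_nat k) = t" for k
    proof (induction k)
      case (Suc k)
      have "\<beta> - of_nat (Suc k) + 1 = \<beta> - of_nat k"
        by simp
      with balanced_const[OF bal, of "\<beta> - of_nat (Suc k)"] * Suc show ?case
        by metis
    qed (use \<beta> in simp)
    then have "range (\<lambda>k. \<beta> - of_nat k) \<subseteq> {\<beta>. count M \<beta> = t}"
      by auto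
    then have "finite (range (\<lambda>k. \<beta> - of_nat k :: 'a))"
      using fin finite_subset by blast
    moreover have "inj (\<lambda>k. \<beta> - of_nat k :: 'a)"
      by (auto intro: injI)
    ultimately show False
      using finite_imageD infinite_UNIV_nat by blast
  qed
  define K where "K = (LEAST k. \<beta> - of_nat (Suc k) \<in># Q + P)"
  have K: "\<beta> - of_nat (Suc K) \<in># Q + P"
    unfolding K_def by (rule LeastI_ex) fact
  have K_least: "\<beta> - of_nat (Suc k) \<notin># Q + P" if "k < K" for k
    using that not_less_Least unfolding K_def by blast
  define D where "D = (\<lambda>k. \<beta> - of_nat k) ` {..K}"
  have D_t: "count M \<delta> = t" if "\<delta> \<in> D" for \<delta>
  proof -
    have "k \<le> K \<Longrightarrow> count M (\<beta> - of_nat k) = t" for k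
    proof (induction k)
      case (Suc k)
      have "\<beta> - of_nat (Suc k) + 1 = \<beta> - of_nat k"
        by simp
      with balanced_const[OF bal, of "\<beta> - of_nat (Suc k)"] K_least[of k] Suc show ?case
        by (metis Suc_le_lessD Suc_leD)
    qed (use \<beta> in simp)
    with that show ?thesis
      by (auto simp: D_def)
  qed
  have \<beta>_D: "\<beta> \<in> D"
    by (auto simp: D_def intro: image_eqI[of _ _ 0])
  have D_supp: "D \<inter> set_mset (Q + P) = {\<beta>}"
  proof -
    have "\<delta> = \<beta>" if "\<delta> \<in> D" "\<delta> \<in># Q + P" for \<delta>
    proof -
      from that(1) obtain k where k: "k \<le> K" "\<delta> = \<beta> - of_nat k"
        by (auto simp: D_def)
      show ?thesis
      proof (cases k)
        case (Suc j)
        with K_least[of j] k that(2) show ?thesis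
          by auto
      qed (use k in simp)
    qed
    with \<beta>_D \<beta>_supp show ?thesis
      by blast
  qed
  have fin_D: "finite D"
    by (simp add: D_def)
  define M' where "M' = M - mset_set D"
  have count': "count M' \<delta> = (if \<delta> \<in> D then t - 1 else count M \<delta>)" for \<delta>
    using fin_D by (auto simp: M'_def D_t count_mset_set')
  have up: "\<delta> + 1 \<in> D" if "\<delta> \<in> D" "\<delta> \<noteq> \<beta>" for \<delta>
  proof -
    from that(1) obtain k where k: "k \<le> K" "\<delta> = \<beta> - of_nat k"
      by (auto simp: D_def)
    with that(2) obtain j where "k = Suc j"
      by (cases k) auto
    with k show ?thesis
      by (auto simp: D_def intro!: image_eqI[of _ _ j])
  qed
  have down: "\<delta> = \<beta> - of_nat (Suc K)" if "\<delta> + 1 \<in> D" "\<delta> \<notin> D" for \<delta>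
  proof -
    from that(1) obtain k where k: "k \<le> K" "\<delta> + 1 = \<beta> - of_nat k"
      by (auto simp: D_def)
    then have \<delta>: "\<delta> = \<beta> - of_nat (Suc k)"
      by (simp add: algebra_simps)
    have "\<not> Suc k \<le> K"
    proof
      assume "Suc k \<le> K"
      then have "\<delta> \<in> D"
        unfolding \<delta> D_def by (intro imageI) simp
      with that(2) show False ..
    qed
    with k \<delta> show ?thesis
      by (metis le_antisym not_less_eq_eq)
  qed
  have "balanced Q P M'"
    unfolding balanced_def
  proof
    fix \<delta>
    show "count M' \<delta> \<le> count M' (\<delta> + 1) + count Q \<delta> \<and> count M' (\<delta> + 1) \<le> count M' \<delta> + count P \<delta>"
    proof (cases "\<delta> \<in> D")
      case True
      show ?thesis
      proof (cases "\<delta> + 1 \<in> D")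
        case False
        with True up have [simp]: "\<delta> = \<beta>"
          by blast
        have "count M (\<beta> + 1) < t + count P \<beta>"
          using \<beta>(2) le_t[of "\<beta> + 1"] by (auto simp: le_less_trans simp flip: count_greater_zero_iff)
        moreover have "count M' \<beta> = t - 1" "count M' (\<beta> + 1) = count M (\<beta> + 1)"
          using False True by (simp_all add: count')
        ultimately show ?thesis
          using \<beta>(1) t(1) balancedD(1)[OF bal, of \<beta>] by (simp, arith)
      qed (use True in \<open>simp add: count'\<close>)
    next
      case False
      show ?thesis
      proof (cases "\<delta> + 1 \<in> D")
        case True
        then have \<delta>: "\<delta> = \<beta> - of_nat (Suc K)"
          using False by (rule down)
        have "\<delta> \<notin> T" "\<delta> \<in># Q + P"
          using lowest[of K] K unfolding \<delta> by blast+
        then have "count M \<delta> < t + count Q \<delta>"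
          using le_t[of \<delta>] D_t[OF True]
          by (auto simp: T_def order.order_iff_strict simp flip: count_greater_zero_iff)
        moreover have "count M' \<delta> = count M \<delta>" "count M' (\<delta> + 1) = t - 1"
          using False True by (simp_all add: count')
        ultimately show ?thesis
          using D_t[OF True] balancedD(2)[OF bal, of \<delta>] by (simp, arith)
      qed (use False balancedD[OF bal, of \<delta>] in \<open>simp add: count'\<close>)
    qed
  qed
  moreover have "M' \<subset># M"
  proof -
    have "M' \<subseteq># M"
      by (simp add: M'_def)
    moreover have "count M' \<beta> \<noteq> count M \<beta>"
      using \<beta> \<beta>_D t(1) by (simp add: count')
    ultimately show ?thesis
      by (auto simp: subset_mset.less_le)
  qed
  moreover have "weight (set_mset (Q + P)) M = Suc (weight (set_mset (Q + P)) M')"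
  proof -
    let ?S = "set_mset (Q + P)"
    have "weight ?S N = count N \<beta> + (\<Sum>\<delta>\<in>?S - {\<beta>}. count N \<delta>)" for N
      unfolding weight_def using \<beta>_supp by (intro sum.remove) auto
    moreover have "(\<Sum>\<delta>\<in>?S - {\<beta>}. count M' \<delta>) = (\<Sum>\<delta>\<in>?S - {\<beta>}. count M \<delta>)"
      using D_supp by (intro sum.cong) (auto simp: count')
    moreover have "count M \<beta> = Suc (count M' \<beta>)"
      using \<beta> \<beta>_D t(1) by (simp add: count')
    ultimately show ?thesis
      by simp
  qed
  ultimately show thesis
    by (rule that)
qed

lemma ex_balanced_chain:
  fixes M :: "'a::ring_char_0 multiset"
  assumes "balanced Q P M" and "weight (set_mset (Q + P)) M = n"
  shows "\<exists>F. (\<forall>i\<le>n. balanced Q P (F i)) \<and> (\<forall>i<n. F i \<subset># F (Suc i)) \<and> F n = M"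
  using assms
proof (induction n arbitrary: M)
  case 0
  then show ?case
    by (intro exI[of _ "\<lambda>_. M"]) auto
next
  case (Suc n)
  then have "M \<noteq> {#}"
    by (auto simp: weight_def)
  with Suc.prems obtain M' where M': "balanced Q P M'" "M' \<subset># M" "weight (set_mset (Q + P)) M' = n"
    by (metis balanced_step_down nat.inject)
  with Suc.IH obtain F where F: "\<forall>i\<le>n. balanced Q P (F i)" "\<forall>i<n. F i \<subset># F (Suc i)" "F n = M'"
    by blast
  show ?case
    using F M' Suc.prems(1) by (intro exI[of _ "F(Suc n := M)"]) (auto simp: le_Suc_eq less_Suc_eq)
qed

section \<open>Submodules as balanced multisets\<close>

lemma A_q_add: "A_q (M + N) = A_q M * A_q N"
  by (simp add: A_q_def)

lemma A_q_nonzero: "A_q M \<noteq> 0"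
  by (auto simp: A_q_def)

lemma proots_A_q: "proots (A_q M) = M"
proof (induction M)
  case (add \<alpha> M)
  have "proots (A_q (add_mset \<alpha> M)) = proots ([:- \<alpha>, 1:] * A_q M)"
    by (simp add: A_q_def)
  also have "\<dots> = proots [:- \<alpha>, 1:] + proots (A_q M)"
    using A_q_nonzero by (intro proots_mult) auto
  finally show ?case
    by (simp add: add.IH)
qed (simp add: A_q_def)

lemma A_q_dvd_iff: "A_q M dvd A_q N \<longleftrightarrow> M \<subseteq># N"
proof
  assume "A_q M dvd A_q N"
  then obtain r where r: "A_q N = A_q M * r"
    by (elim dvdE)
  moreover have "r \<noteq> 0"
    using r A_q_nonzero[of N] by auto
  ultimately have "proots (A_q N) = M + proots r"
    by (simp add: proots_mult A_q_nonzero proots_A_q)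
  then show "M \<subseteq># N"
    by (simp add: proots_A_q)
next
  assume "M \<subseteq># N"
  then show "A_q M dvd A_q N"
    by (intro A_q_dvd) (simp add: proots_A_q)
qed

lemma A_q_pcompose: "A_q M \<circ>\<^sub>p [:c, 1:] = A_q (image_mset (\<lambda>\<alpha>. \<alpha> - c) M)"
proof (induction M)
  case (add \<alpha> M)
  have "A_q (add_mset \<alpha> M) \<circ>\<^sub>p [:c, 1:] = ([:- \<alpha>, 1:] \<circ>\<^sub>p [:c, 1:]) * (A_q M \<circ>\<^sub>p [:c, 1:])"
    by (simp only: A_q_def image_mset_add_mset prod_mset.add_mset pcompose_mult)
  also have "[:- \<alpha>, 1:] \<circ>\<^sub>p [:c, 1:] = [:- (\<alpha> - c), 1:]"
    by (simp add: pcompose_pCons)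
  finally show ?case
    by (simp only: add.IH) (simp add: A_q_def)
qed (simp add: A_q_def pcompose_1)

lemma count_image_mset_diff:
  fixes M :: "'a::group_add multiset"
  shows "count (image_mset (\<lambda>\<alpha>. \<alpha> - c) M) \<beta> = count M (\<beta> + c)"
  by (induction M) (auto simp: diff_eq_eq)

text \<open>Over an algebraically closed field \<^const>\<open>A_q\<close> inverts \<^const>\<open>proots\<close> up to a unit, so an ideal
  generated by a nonzero polynomial is the same datum as a multiset.\<close>

lemma alg_closed_eq_A_q:
  fixes f :: "'a::alg_closed_field poly"
  assumes "f \<noteq> 0"
  obtains c where "c \<noteq> 0" and "f = Polynomial.smult c (A_q (proots f))"
proof -
  from alg_closed_imp_factorization[OF assms] obtain A
    where "f = Polynomial.smult (lead_coeff f) (A_q A)"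
    unfolding A_q_def by blast
  moreover have "proots (Polynomial.smult (lead_coeff f) (A_q A)) = A"
    using assms by (simp add: proots_A_q)
  ultimately have "f = Polynomial.smult (lead_coeff f) (A_q (proots f))"
    by metis
  with assms show thesis
    by (metis leading_coeff_0_iff that)
qed

text \<open>The polynomial by which \<open>y\<close> twists is, up to a unit, the shifted product over the roots that
  \<open>X\<close> leaves over; this makes the conditions imposed by \<open>x\<close> and by \<open>y\<close> symmetric.\<close>

lemma A_p_eq_A_q:
  assumes X: "X \<subseteq># proots (u + [:C:])"
    and c: "u + [:C:] = Polynomial.smult c (A_q (proots (u + [:C:])))"
  shows "A_p u C X = Polynomial.smult c (A_q (proots (u + [:C:]) - X) \<circ>\<^sub>p [:- 1, 1:])"
proof -
  let ?R = "proots (u + [:C:])"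
  have "A_q ?R = A_q X * A_q (?R - X)"
    using X by (simp flip: A_q_add)
  then have "A_p u C X * (A_q X \<circ>\<^sub>p [:- 1, 1:]) =
      Polynomial.smult c (A_q (?R - X) \<circ>\<^sub>p [:- 1, 1:]) * (A_q X \<circ>\<^sub>p [:- 1, 1:])"
    unfolding A_p_mult[OF X] by (subst c) (simp only: pcompose_smult pcompose_mult mult_smult_left mult_smult_right mult.commute)
  moreover have "A_q X \<circ>\<^sub>p [:- 1, 1:] \<noteq> 0"
    by (simp add: A_q_pcompose A_q_nonzero)
  ultimately show ?thesis
    using mult_cancel_right by blast
qed

text \<open>Multiplication by a polynomial \<open>s\<close> is the action of \<open>s(h)\<close>, and conversely every element of the
  Smith algebra acts as a linear combination of compositions of generator actions. This removes the
  quotient of the free algebra from the rest of the argument.\<close>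

lemma submodule_A_module_iff:
  assumes X: "X \<subseteq># proots (u + [:C:])" and g: "g = u \<circ>\<^sub>p [:- 1, 1:] - u"
  shows "submodule N (smith_algebra g) (A_module u C X) \<longleftrightarrow>
    0 \<in> N \<and> (\<forall>f\<in>N. \<forall>f'\<in>N. f + f' \<in> N) \<and> (\<forall>f\<in>N. \<forall>s. s * f \<in> N) \<and>
    (\<forall>f\<in>N. (f \<circ>\<^sub>p [:1, 1:]) * A_q X \<in> N) \<and> (\<forall>f\<in>N. (f \<circ>\<^sub>p [:- 1, 1:]) * A_p u C X \<in> N)"
    (is "?sub \<longleftrightarrow> ?closed")
proof
  let ?M = "A_module u C X"
  assume ?sub
  then interpret submodule N "smith_algebra g" ?M .
  have act: "free_act (A_q X) (A_p u C X) a f \<in> N" if "f \<in> N" for a f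
    using smult_closed[OF _ that, of "smith_class g a"] A_module_smult[OF X g, of a f]
    by (simp add: smith_algebra_carrier)
  have "0 \<in> N"
    using one_closed by (simp add: A_module_def)
  moreover have "f + f' \<in> N" if "f \<in> N" "f' \<in> N" for f f'
    using m_closed[OF that] by (simp add: A_module_def)
  moreover have "s * f \<in> N" if "f \<in> N" for s f
    using act[OF that, of "free_eval s (free_gen GH)"] by (simp only: free_act_eval_GH)
  moreover have "(f \<circ>\<^sub>p [:1, 1:]) * A_q X \<in> N" if "f \<in> N" for f
    using act[OF that, of "free_gen GX"] by (simp only: free_act_gen gen_act.simps)
  moreover have "(f \<circ>\<^sub>p [:- 1, 1:]) * A_p u C X \<in> N" if "f \<in> N" for f
    using act[OF that, of "free_gen GY"] by (simp only: free_act_gen gen_act.simps)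
  ultimately show ?closed
    by (intro conjI ballI allI)
next
  let ?M = "A_module u C X" and ?act = "free_act (A_q X) (A_p u C X)"
  assume ?closed
  then have N: "0 \<in> N" "\<And>f f'. f \<in> N \<Longrightarrow> f' \<in> N \<Longrightarrow> f + f' \<in> N" "\<And>f s. f \<in> N \<Longrightarrow> s * f \<in> N"
    "\<And>f. f \<in> N \<Longrightarrow> (f \<circ>\<^sub>p [:1, 1:]) * A_q X \<in> N"
    "\<And>f. f \<in> N \<Longrightarrow> (f \<circ>\<^sub>p [:- 1, 1:]) * A_p u C X \<in> N"
    by simp_all
  interpret left_module "smith_algebra g" ?M
    by (rule A_module_left_module[OF X g])
  have smult: "Polynomial.smult c f \<in> N" if "f \<in> N" for c f
  proof -
    have "[:c:] * f \<in> N"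
      using that by (rule N(3))
    then show ?thesis
      by simp
  qed
  have word: "word_act (A_q X) (A_p u C X) w f \<in> N" if "f \<in> N" for w f
  proof -
    have "gen_act (A_q X) (A_p u C X) c f \<in> N" if "f \<in> N" for c f
      using N(3-5) that by (cases c) (simp_all only: gen_act.simps)
    then have "foldr (gen_act (A_q X) (A_p u C X)) l f \<in> N" for l
      using that by (induction l) auto
    then show ?thesis
      by (simp add: word_act_def)
  qed
  have act: "?act a f \<in> N" if "f \<in> N" for a f
  proof (induction a rule: poly_mapping_single_induct)
    case (single w d)
    then show ?case
      using smult word that by (simp add: free_act_single)
  next
    case (sum a b)
    then show ?case
      using N(2) by (simp add: free_act_plus)
  qed
  have "inv\<^bsub>add_monoid ?M\<^esub> f = - f" for f
    using M.minus_equality[of "- f" f] by (simp add: A_module_def a_inv_def)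
  moreover have "- f \<in> N" if "f \<in> N" for f
    using smult[OF that, of "- 1"] by simp
  ultimately have "subgroup N (add_monoid ?M)"
    using N(1,2) by (intro subgroup.intro) (auto simp: A_module_def)
  then show ?sub
    by (intro submodule.intro submodule_axioms.intro)
      (auto simp: smith_algebra_carrier A_module_smult[OF X g] act)
qed

lemma poly_ideal_principal:
  fixes N :: "'a::field poly set"
  assumes zero: "0 \<in> N" and add: "\<And>f f'. f \<in> N \<Longrightarrow> f' \<in> N \<Longrightarrow> f + f' \<in> N"
    and mult: "\<And>f s. f \<in> N \<Longrightarrow> s * f \<in> N"
  obtains a where "N = {f. a dvd f}"
proof (cases "N = {0}")
  case True
  then show thesis
    by (intro that[of 0]) auto
next
  case False
  with zero obtain b where "b \<in> N \<and> b \<noteq> 0"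
    by blast
  from ex_has_least_nat[of "\<lambda>b. b \<in> N \<and> b \<noteq> 0", OF this, of Polynomial.degree]
  obtain a where a: "a \<in> N" "a \<noteq> 0"
    and least: "\<And>f. f \<in> N \<Longrightarrow> f \<noteq> 0 \<Longrightarrow> Polynomial.degree a \<le> Polynomial.degree f"
    by auto
  have "a dvd f" if "f \<in> N" for f
  proof -
    have "f mod a = f + (- (f div a)) * a"
      by (simp add: minus_div_mult_eq_mod [symmetric])
    also have "\<dots> \<in> N"
      by (rule add[OF that mult[OF a(1)]])
    finally have mem: "f mod a \<in> N" .
    have "f mod a = 0"
    proof (rule ccontr)
      assume nz: "f mod a \<noteq> 0"
      with mem have "Polynomial.degree a \<le> Polynomial.degree (f mod a)"
        by (rule least)
      with degree_mod_less'[OF a(2) nz] show False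
        by simp
    qed
    then show ?thesis
      by (simp add: dvd_eq_mod_eq_0)
  qed
  moreover have "f \<in> N" if "a dvd f" for f
  proof -
    from that obtain s where "f = a * s" ..
    then show ?thesis
      using mult[OF a(1), of s] by (simp only: mult.commute)
  qed
  ultimately have "f \<in> N \<longleftrightarrow> a dvd f" for f
    by (rule iffI)
  then have "N = {f. a dvd f}"
    by (intro Set.set_eqI) (simp only: mem_Collect_eq)
  then show thesis
    by (rule that)
qed

definition A_ideal :: "'a::field multiset \<Rightarrow> 'a poly set"
  where "A_ideal M = {f. A_q M dvd f}"

lemma A_ideal_subset_iff: "A_ideal M \<subseteq> A_ideal N \<longleftrightarrow> N \<subseteq># M"
proof -
  have "A_ideal M \<subseteq> A_ideal N \<longleftrightarrow> A_q N dvd A_q M"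
  proof
    assume "A_ideal M \<subseteq> A_ideal N"
    moreover have "A_q M \<in> A_ideal M"
      by (simp add: A_ideal_def)
    ultimately have "A_q M \<in> A_ideal N"
      by (rule subsetD)
    then show "A_q N dvd A_q M"
      by (simp add: A_ideal_def)
  next
    assume dvd: "A_q N dvd A_q M"
    show "A_ideal M \<subseteq> A_ideal N"
      unfolding A_ideal_def by (intro Collect_mono impI) (rule dvd_trans[OF dvd])
  qed
  then show ?thesis
    by (simp only: A_q_dvd_iff)
qed

text \<open>Both \<open>x\<close> and \<open>y\<close> act by a ring endomorphism followed by a multiplication, so whether they
  preserve a principal ideal can be read off from the generator alone.\<close>

lemma A_ideal_closed_twisted_iff:
  "(\<forall>f\<in>A_ideal M. (f \<circ>\<^sub>p r) * k \<in> A_ideal M) \<longleftrightarrow> A_q M dvd (A_q M \<circ>\<^sub>p r) * k"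
proof
  assume "\<forall>f\<in>A_ideal M. (f \<circ>\<^sub>p r) * k \<in> A_ideal M"
  moreover have "A_q M \<in> A_ideal M"
    by (simp add: A_ideal_def)
  ultimately have "(A_q M \<circ>\<^sub>p r) * k \<in> A_ideal M"
    by (rule bspec)
  then show "A_q M dvd (A_q M \<circ>\<^sub>p r) * k"
    by (simp add: A_ideal_def)
next
  assume dvd: "A_q M dvd (A_q M \<circ>\<^sub>p r) * k"
  show "\<forall>f\<in>A_ideal M. (f \<circ>\<^sub>p r) * k \<in> A_ideal M"
  proof
    fix f assume "f \<in> A_ideal M"
    then obtain s where "f = A_q M * s"
      by (auto simp: A_ideal_def)
    then have "(f \<circ>\<^sub>p r) * k = ((A_q M \<circ>\<^sub>p r) * k) * (s \<circ>\<^sub>p r)"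
      by (simp only: pcompose_mult mult_ac)
    with dvd show "(f \<circ>\<^sub>p r) * k \<in> A_ideal M"
      unfolding A_ideal_def by (metis dvd_mult2 mem_Collect_eq)
  qed
qed

text \<open>Comparing multiplicities at \<open>\<beta>\<close> in the divisibility conditions for \<open>x\<close> and at \<open>\<beta> + 1\<close> in those
  for \<open>y\<close> gives exactly the two inequalities of a balanced multiset.\<close>

lemma submodule_A_ideal_iff:
  fixes u :: "'a::alg_closed_field poly"
  assumes X: "X \<subseteq># proots (u + [:C:])" and g: "g = u \<circ>\<^sub>p [:- 1, 1:] - u"
    and nz: "u + [:C:] \<noteq> 0"
  shows "submodule (A_ideal M) (smith_algebra g) (A_module u C X) \<longleftrightarrow>
    balanced X (proots (u + [:C:]) - X) M"
proof -
  let ?P = "proots (u + [:C:]) - X"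
  obtain c where "c \<noteq> 0" and c: "u + [:C:] = Polynomial.smult c (A_q (proots (u + [:C:])))"
    using alg_closed_eq_A_q[OF nz] by blast
  have x: "(\<forall>f\<in>A_ideal M. (f \<circ>\<^sub>p [:1, 1:]) * A_q X \<in> A_ideal M) \<longleftrightarrow>
      (\<forall>\<beta>. count M \<beta> \<le> count M (\<beta> + 1) + count X \<beta>)"
  proof -
    have "(\<forall>f\<in>A_ideal M. (f \<circ>\<^sub>p [:1, 1:]) * A_q X \<in> A_ideal M) \<longleftrightarrow>
        A_q M dvd (A_q M \<circ>\<^sub>p [:1, 1:]) * A_q X"
      by (rule A_ideal_closed_twisted_iff)
    also have "\<dots> \<longleftrightarrow> M \<subseteq># image_mset (\<lambda>\<alpha>. \<alpha> - 1) M + X"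
      by (simp add: A_q_pcompose A_q_dvd_iff flip: A_q_add)
    finally show ?thesis
      by (simp add: subseteq_mset_def count_image_mset_diff)
  qed
  have y: "(\<forall>f\<in>A_ideal M. (f \<circ>\<^sub>p [:- 1, 1:]) * A_p u C X \<in> A_ideal M) \<longleftrightarrow>
      (\<forall>\<beta>. count M (\<beta> + 1) \<le> count M \<beta> + count ?P \<beta>)"
  proof -
    have "(\<forall>f\<in>A_ideal M. (f \<circ>\<^sub>p [:- 1, 1:]) * A_p u C X \<in> A_ideal M) \<longleftrightarrow>
        A_q M dvd (A_q M \<circ>\<^sub>p [:- 1, 1:]) * A_p u C X"
      by (rule A_ideal_closed_twisted_iff)
    also have "\<dots> \<longleftrightarrow> A_q M dvd (A_q (M + ?P) \<circ>\<^sub>p [:- 1, 1:])"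
    proof -
      have "(A_q M \<circ>\<^sub>p [:- 1, 1:]) * A_p u C X = Polynomial.smult c (A_q (M + ?P) \<circ>\<^sub>p [:- 1, 1:])"
        by (simp only: A_p_eq_A_q[OF X c] A_q_add pcompose_mult mult_smult_right)
      then show ?thesis
        using \<open>c \<noteq> 0\<close> by (metis dvd_smult_iff)
    qed
    also have "\<dots> \<longleftrightarrow> M \<subseteq># image_mset (\<lambda>\<alpha>. \<alpha> - (- 1)) (M + ?P)"
      by (simp only: A_q_pcompose A_q_dvd_iff)
    also have "\<dots> \<longleftrightarrow> (\<forall>\<beta>. count M \<beta> \<le> count (M + ?P) (\<beta> + - 1))"
      unfolding subseteq_mset_def count_image_mset_diff ..
    also have "\<dots> \<longleftrightarrow> (\<forall>\<beta>. count M (\<beta> + 1) \<le> count (M + ?P) \<beta>)"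
    proof safe
      show "count M (\<beta> + 1) \<le> count (M + ?P) \<beta>" if "\<forall>\<beta>. count M \<beta> \<le> count (M + ?P) (\<beta> + - 1)" for \<beta>
        using that[rule_format, of "\<beta> + 1"] by simp
      show "count M \<beta> \<le> count (M + ?P) (\<beta> + - 1)" if "\<forall>\<beta>. count M (\<beta> + 1) \<le> count (M + ?P) \<beta>" for \<beta>
        using that[rule_format, of "\<beta> + - 1"] by simp
    qed
    finally show ?thesis
      by simp
  qed
  have "0 \<in> A_ideal M" "\<forall>f\<in>A_ideal M. \<forall>f'\<in>A_ideal M. f + f' \<in> A_ideal M"
    "\<forall>f\<in>A_ideal M. \<forall>s. s * f \<in> A_ideal M"
    by (simp_all add: A_ideal_def)
  then show ?thesis
    unfolding submodule_A_module_iff[OF X g] x y balanced_def all_conj_distrib by argo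
qed

lemma submodule_A_module_cases:
  fixes u :: "'a::alg_closed_field poly"
  assumes X: "X \<subseteq># proots (u + [:C:])" and g: "g = u \<circ>\<^sub>p [:- 1, 1:] - u"
    and nz: "u + [:C:] \<noteq> 0"
    and sub: "submodule N (smith_algebra g) (A_module u C X)" and "N \<noteq> {0}"
  obtains M where "balanced X (proots (u + [:C:]) - X) M" and "N = A_ideal M"
proof -
  have N: "0 \<in> N" "\<And>f f'. f \<in> N \<Longrightarrow> f' \<in> N \<Longrightarrow> f + f' \<in> N" "\<And>f s. f \<in> N \<Longrightarrow> s * f \<in> N"
    using sub unfolding submodule_A_module_iff[OF X g] by simp_all
  then obtain a where a: "N = {f. a dvd f}"
    by (rule poly_ideal_principal)
  with \<open>N \<noteq> {0}\<close> have "a \<noteq> 0"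
    by auto
  then obtain c where c: "c \<noteq> 0" "a = Polynomial.smult c (A_q (proots a))"
    using alg_closed_eq_A_q by blast
  have "a dvd f \<longleftrightarrow> A_q (proots a) dvd f" for f
    using smult_dvd_iff[of c "A_q (proots a)" f] c by metis
  then have "N = A_ideal (proots a)"
    by (simp add: a A_ideal_def)
  with sub that show thesis
    using submodule_A_ideal_iff[OF X g nz] by blast
qed

section \<open>The length of the module\<close>

lemma A_ideal_psubset_iff: "A_ideal M \<subset> A_ideal N \<longleftrightarrow> N \<subset># M"
  by (simp add: less_le_not_le subset_mset.less_le_not_le A_ideal_subset_iff)

text \<open>Only the lowest term of a strict chain can be zero. From the next one on, the terms correspond
  to balanced multisets of decreasing weight, which starts at most at the weight of \<^const>\<open>phi\<close>.\<close>

lemma submodule_chain_length_le: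
  fixes u :: "'a::{alg_closed_field, field_char_0} poly"
  assumes X: "X \<subseteq># proots (u + [:C:])" and g: "g = u \<circ>\<^sub>p [:- 1, 1:] - u"
    and nz: "u + [:C:] \<noteq> 0"
    and chain: "submodule_chain (smith_algebra g) (A_module u C X) n N"
  shows "n \<le> 1 + (\<Sum>\<beta>\<in>set_mset (proots (u + [:C:])). phi (proots (u + [:C:])) X \<beta>)"
proof (cases n)
  case (Suc m)
  let ?R = "proots (u + [:C:])"
  let ?w = "weight (set_mset ?R)"
  have R: "X + (?R - X) = ?R"
    using X by simp
  have sub: "submodule (N i) (smith_algebra g) (A_module u C X)" if "i \<le> n" for i
    using chain that by (simp add: submodule_chain_def)
  have strict: "N i \<subset> N (Suc i)" if "i < n" for i
    using chain that by (simp add: submodule_chain_def)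
  have "\<exists>M. balanced X (?R - X) M \<and> N (Suc i) = A_ideal M" if "i < n" for i
  proof -
    have "submodule (N i) (smith_algebra g) (A_module u C X)"
      using that by (intro sub) simp
    then have "0 \<in> N i"
      unfolding submodule_A_module_iff[OF X g] by (rule conjunct1)
    have "N (Suc i) \<noteq> {0}"
    proof
      assume "N (Suc i) = {0}"
      with strict[OF that] have "N i = {}"
        by (simp add: psubset_eq subset_singleton_iff) metis
      with \<open>0 \<in> N i\<close> show False
        by simp
    qed
    moreover have "submodule (N (Suc i)) (smith_algebra g) (A_module u C X)"
      using that by (intro sub) simp
    ultimately obtain M where "balanced X (?R - X) M" "N (Suc i) = A_ideal M"
      using submodule_A_module_cases[OF X g nz] by metis
    then show ?thesis
      by blast
  qed
  then obtain M where M: "\<And>i. i < n \<Longrightarrow> balanced X (?R - X) (M i)"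
    "\<And>i. i < n \<Longrightarrow> N (Suc i) = A_ideal (M i)"
    by metis
  have weight: "i < n \<Longrightarrow> ?w (M i) + i \<le> ?w (M 0)" for i
  proof (induction i)
    case (Suc i)
    have "M (Suc i) \<subset># M i"
      using strict[of "Suc i"] Suc.prems M(2)[of i] M(2)[of "Suc i"] by (simp add: A_ideal_psubset_iff)
    then have "?w (M (Suc i)) < ?w (M i)"
      using Suc.prems by (intro weight_less[of X "?R - X", unfolded R] M(1)) simp_all
    with Suc.IH Suc.prems show ?case
      by linarith
  qed simp
  have "m \<le> ?w (M 0)"
    using weight[of m] Suc by simp
  also have "\<dots> \<le> (\<Sum>\<beta>\<in>set_mset ?R. phi ?R X \<beta>)"
    unfolding weight_def using balanced_count_le_phi[OF M(1)[of 0], unfolded R] Suc by (intro sum_mono) simp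
  finally show ?thesis
    using Suc by simp
qed simp

lemma ex_submodule_chain:
  fixes u :: "'a::{alg_closed_field, field_char_0} poly"
  assumes X: "X \<subseteq># proots (u + [:C:])" and g: "g = u \<circ>\<^sub>p [:- 1, 1:] - u"
    and nz: "u + [:C:] \<noteq> 0"
  shows "\<exists>N. submodule_chain (smith_algebra g) (A_module u C X)
    (1 + (\<Sum>\<beta>\<in>set_mset (proots (u + [:C:])). phi (proots (u + [:C:])) X \<beta>)) N"
proof -
  let ?R = "proots (u + [:C:])"
  define W where "W = (\<Sum>\<beta>\<in>set_mset ?R. phi ?R X \<beta>)"
  have R: "X + (?R - X) = ?R"
    using X by simp
  obtain M where M: "balanced X (?R - X) M" "count M = phi ?R X"
    using ex_balanced_phi[of X "?R - X"] unfolding R by blast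
  have "weight (set_mset (X + (?R - X))) M = W"
    by (simp only: R weight_def W_def M(2))
  from ex_balanced_chain[OF M(1) this] obtain F
    where F: "\<And>i. i \<le> W \<Longrightarrow> balanced X (?R - X) (F i)" "\<And>i. i < W \<Longrightarrow> F i \<subset># F (Suc i)"
    by blast
  \<comment> \<open>Larger multisets give smaller ideals, so the chain of multisets is traversed backwards, above
    the zero submodule.\<close>
  define N where "N i = (if i = 0 then {0} else A_ideal (F (Suc W - i)))" for i
  have "submodule (N i) (smith_algebra g) (A_module u C X)" if "i \<le> Suc W" for i
  proof (cases "i = 0")
    case True
    then show ?thesis
      by (simp add: N_def submodule_A_module_iff[OF X g])
  next
    case False
    then show ?thesis
      using F(1)[of "Suc W - i"] by (simp add: N_def submodule_A_ideal_iff[OF X g nz])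
  qed
  moreover have "N i \<subset> N (Suc i)" if "i < Suc W" for i
  proof (cases "i = 0")
    case True
    have "A_q (F W) \<in> A_ideal (F W)" "0 \<in> A_ideal (F W)"
      by (simp_all add: A_ideal_def)
    with A_q_nonzero[of "F W"] True show ?thesis
      by (auto simp: N_def)
  next
    case False
    with that have "F (W - i) \<subset># F (Suc W - i)"
      using F(2)[of "W - i"] by (simp add: Suc_diff_le)
    with False show ?thesis
      by (simp add: N_def A_ideal_psubset_iff)
  qed
  ultimately show ?thesis
    unfolding submodule_chain_def W_def[symmetric] by auto
qed

theorem corollary3p30:
  fixes g u :: "'a::{alg_closed_field, field_char_0} poly" and C :: 'a and X :: "'a multiset"
  assumes "g \<noteq> 0"
    and "g = u \<circ>\<^sub>p [:- 1, 1:] - u"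
    and "X \<subseteq># proots (u + [:C:])"
  shows "module_length (smith_algebra g) (A_module u C X) =
    enat (1 + (\<Sum>\<beta>\<in>set_mset (proots (u + [:C:])). phi (proots (u + [:C:])) X \<beta>))"
proof -
  have nz: "u + [:C:] \<noteq> 0"
  proof
    assume "u + [:C:] = 0"
    then have "u = [:- C:]"
      by (simp add: add_eq_0_iff2)
    with assms(1,2) show False
      by simp
  qed
  show ?thesis
    unfolding module_length_def
  proof (rule antisym[OF Sup_least Sup_upper])
    fix l assume "l \<in> {enat n |n. \<exists>N. submodule_chain (smith_algebra g) (A_module u C X) n N}"
    then show "l \<le> enat (1 + (\<Sum>\<beta>\<in>set_mset (proots (u + [:C:])). phi (proots (u + [:C:])) X \<beta>))"
      using submodule_chain_length_le[OF assms(3,2) nz] by auto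
  next
    show "enat (1 + (\<Sum>\<beta>\<in>set_mset (proots (u + [:C:])). phi (proots (u + [:C:])) X \<beta>))
        \<in> {enat n |n. \<exists>N. submodule_chain (smith_algebra g) (A_module u C X) n N}"
      using ex_submodule_chain[OF assms(3,2) nz] by blast
  qed
qed

end
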